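(* Let $A,A_1,A_2$ be positive constants and let $P_{\mathrm e}(y_2;\sigma,\kappa)=\sigma P_\sigma(y_2)+\kappa P_\kappa(y_2)$. Consider, for $\sigma,\kappa>0$, the equation for $\dot\xi\in(0,L)$ $$R(\dot\xi;\sigma,\kappa)=P_*(\sigma,\kappa).\qquad(\ast)$$ (i) Suppose $\kappa=A_1\sigma^s$ with $s>1$. Let $\overline{R_\sigma}=\sup_{(0,L)}R_\sigma$, $\underline{R_\sigma}=\inf_{(0,L)}R_\sigma$. If $P_{\sigma*}\in(\underline{R_\sigma},\overline{R_\sigma})$, $\bar\xi_*\in(0,L)$ is a solution of $R_\sigma(\bar\xi_* )=P_{\sigma*}$ and $\Theta(\bar\xi_* )\neq0$, then there exist constants $\sigma_1>0$ and $C_2$ such that for each $\sigma\in(0,\sigma_1)$ equation $(\ast)$ has a solution $\dot\xi(\sigma,\kappa)$ with $|\dot\xi(\sigma,\kappa)-\bar\xi_*|\le C_2\sigma^{s-1}$. (ii) Suppose $\sigma=A_2\kappa^s$ with $s>1$. Let $\overline{R_\kappa}=\sup_{(0,L)}R_\kappa$, $\underline{R_\kappa}=\inf_{(0,L)}R_\kappa$. If $P_{\kappa*}\in(\underline{R_\kappa},\overline{R_\kappa})$ and $\bar\xi_*\in(0,L)$ is a solution of $R_\kappa(\bar\xi_* )=P_{\kappa*}$, then there exist constants $\kappa_1>0$ and $C_1$ such that for each $\kappa\in(0,\kappa_1)$ equation $(\ast)$ has a solution $\dot\xi(\sigma,\kappa)$ with $|\dot\xi(\sigma,\kappa)-\bar\xi_*|\le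 C_1\kappa^{s-1}$. (iii) Suppose $\sigma=A\kappa$, so $P_{\mathrm e}=\kappa P_A$ with $P_A=AP_\sigma+P_\kappa$. Let $R_A=AR_\sigma+R_\kappa$, $\overline{R_A}=\sup_{(0,L)}R_A$, $\underline{R_A}=\inf_{(0,L)}R_A$. If $P_{A*}\in(\underline{R_A},\overline{R_A})$, then there exists a constant $\bar\xi_*\in(0,L)$ such that $(\ast)$ holds with $\dot\xi(\sigma,\kappa)\equiv\bar\xi_*$. (iv) Suppose $(P_{\sigma*},P_{\kappa*})\in\mathcal C:=\{(R_\sigma(\xi),R_\kappa(\xi)):\xi\in(0,L)\}$. Then there exists $\bar\xi_*\in(0,L)$ such that $(\ast)$ holds with $\dot\xi(\sigma,\kappa)\equiv\bar\xi_*$.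
   Context: Fixed constants $\gamma>1$, $c_{\mathrm v}>0$, $\mathcal R=(\gamma-1)c_{\mathrm v}$, $q_{\mathrm e}>0$, $T_0,a,\mathcal E,\mathcal R_0>0$, $L>0$. A gas state $U=(p,\theta,q,S,Z)^\top$ has density $\rho$ given by $p=(\gamma-1)e^{S/c_{\mathrm v}}\rho^\gamma$, temperature $T=p/(\mathcal R\rho)$, sound speed $c=\sqrt{\gamma p/\rho}$, Mach number $M=q/c$. $\phi(T)=T^ae^{-\mathcal E/(\mathcal R_0(T-T_0))}$ for $T>T_0$ and $\phi(T)=0$ for $T\le T_0$. $\bar U_-=(\bar p_-,0,\bar q_-,\bar S_-,\bar Z)^\top$ is a constant supersonic state ($\bar M_->1$) with $\bar T_->T_0$, $0<\bar Z\le1$; $\bar U_+=(\bar p_+,0,\bar q_+,\bar S_+,\bar Z)^\top$ is the unique constant subsonic state ($\bar M_+<1$) with $[\bar\rho\bar q]=0$, $[\bar\rho\bar q^2+\bar p]=0$, $[\frac12\bar q^2+\frac{\gamma\bar p}{(\gamma-1)\bar\rho}]=0$, where $[w]=w_+-w_-$. Normalization $\bar\rho_\pm\bar q_\pm=1$. $\Theta\in C^{2,\alpha}[0,L]$, $0<\alpha<1$, with $\Theta(0)=\Theta'(0)=\Theta''(0)=0$; $P_\sigma,P_\kappa\in C^{2,\alpha}([0,\infty))$, independent of $\sigma,\kappa$. $\bar f_1^+=\frac1{\gamma c_{\mathrm v}}\frac1{\bar\rho_+\bar q_+^2}\frac{\phi(\bar T_+)}{\bar T_+}q_{\mathrm e}\bar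 Z$, $$\dot K_1=[\bar p]\Big(\frac{\gamma-1}{\gamma\bar p_+}+\frac1{\bar\rho_+\bar q_+^2}\Big)>0,\qquad \dot K_2=\frac1{\gamma c_{\mathrm v}}\frac1{\bar T_+}q_{\mathrm e}\bar Z\Big(\frac{\phi(\bar T_+)}{\bar\rho_+\bar q_+^2}-\frac{\phi(\bar T_-)}{\bar\rho_-\bar q_-^2}\Big)>0,$$ $$R_\sigma(\xi)=\int_0^L\Theta(y_1)\,dy_1-\dot K_1\int_0^\xi\Theta(y_1)\,dy_1,\qquad R_\kappa(\xi)=-\bar f_1^+L+\dot K_2\xi,$$ $R(\xi;\sigma,\kappa)=\sigma R_\sigma(\xi)+\kappa R_\kappa(\xi)$, $P_*(\sigma,\kappa)=\frac1{\bar\rho_+\bar q_+}\frac{1-\bar M_+^2}{\bar\rho_+\bar q_+^2}\int_0^1P_{\mathrm e}(y_2;\sigma,\kappa)\,dy_2$, and similarly $P_{\sigma*},P_{\kappa*},P_{A*}$ are $\frac1{\bar\rho_+\bar q_+}\frac{1-\bar M_+^2}{\bar\rho_+\bar q_+^2}\int_0^1 P\,dy_2$ with $P=P_\sigma,P_\kappa,P_A$ respectively. *)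

theory Defs
  imports "HOL-Analysis.Analysis"
begin

record gas =
  gas_gamma :: real
  gas_cv :: real
  gas_qe :: real
  gas_T0 :: real
  gas_a :: real
  gas_E :: real
  gas_R0 :: real

definition gas_constants :: "gas \<Rightarrow> bool" where
  "gas_constants G \<longleftrightarrow>
     gas_gamma G > 1 \<and> gas_cv G > 0 \<and> gas_qe G > 0 \<and> gas_T0 G > 0 \<and>
     gas_a G > 0 \<and> gas_E G > 0 \<and> gas_R0 G > 0"

text \<open>The state \<open>U = (p, \<theta>, q, S, Z)\<close>.\<close>

record state =
  pressure :: real
  angle :: real
  speed :: real
  entropy :: real
  reactant :: real

definition gas_R :: "gas \<Rightarrow> real" where
  "gas_R G = (gas_gamma G - 1) * gas_cv G"

definition density :: "gas \<Rightarrow> state \<Rightarrow> real" where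
  "density G U = (THE \<rho>. \<rho> > 0 \<and>
     pressure U = (gas_gamma G - 1) * exp (entropy U / gas_cv G) * \<rho> powr gas_gamma G)"

definition temperature :: "gas \<Rightarrow> state \<Rightarrow> real" where
  "temperature G U = pressure U / (gas_R G * density G U)"

definition sound_speed :: "gas \<Rightarrow> state \<Rightarrow> real" where
  "sound_speed G U = sqrt (gas_gamma G * pressure U / density G U)"

definition mach :: "gas \<Rightarrow> state \<Rightarrow> real" where
  "mach G U = speed U / sound_speed G U"

definition ignition :: "gas \<Rightarrow> real \<Rightarrow> real" where
  "ignition G T =
     (if T > gas_T0 G then T powr gas_a G * exp (- gas_E G / (gas_R0 G * (T - gas_T0 G))) else 0)"

lemma density_ex1:
  assumes "gas_constants G" "pressure U > 0"
  shows "\<exists>!\<rho>. \<rho> > 0 \<and>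
     pressure U = (gas_gamma G - 1) * exp (entropy U / gas_cv G) * \<rho> powr gas_gamma G"
proof -
  define g where "g = gas_gamma G"
  define c where "c = (g - 1) * exp (entropy U / gas_cv G)"
  have g: "g > 1" using assms(1) by (simp add: gas_constants_def g_def)
  have c: "c > 0" using g by (simp add: c_def)
  have "\<exists>!\<rho>. \<rho> > 0 \<and> pressure U = c * \<rho> powr g"
  proof (rule ex1I[of _ "(pressure U / c) powr (1 / g)"])
    show "(pressure U / c) powr (1 / g) > 0 \<and>
        pressure U = c * ((pressure U / c) powr (1 / g)) powr g"
      using g c assms(2) by (simp add: powr_powr)
  next
    fix \<rho> assume "\<rho> > 0 \<and> pressure U = c * \<rho> powr g"
    then show "\<rho> = (pressure U / c) powr (1 / g)"
      using g c by (simp add: powr_powr)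
  qed
  then show ?thesis by (simp add: c_def g_def)
qed

text \<open>The Rankine--Hugoniot conditions across a normal shock between two constant states with
  vanishing flow angle. Within these, the subsonic state behind a given supersonic one is
  unique.\<close>

definition rankine_hugoniot :: "gas \<Rightarrow> state \<Rightarrow> state \<Rightarrow> bool" where
  "rankine_hugoniot G Um Up \<longleftrightarrow>
     density G Up * speed Up - density G Um * speed Um = 0 \<and>
     (density G Up * (speed Up)\<^sup>2 + pressure Up)
       - (density G Um * (speed Um)\<^sup>2 + pressure Um) = 0 \<and>
     ((speed Up)\<^sup>2 / 2 + gas_gamma G * pressure Up / ((gas_gamma G - 1) * density G Up))
       - ((speed Um)\<^sup>2 / 2 + gas_gamma G * pressure Um / ((gas_gamma G - 1) * density G Um)) = 0"

definition background_states :: "gas \<Rightarrow> state \<Rightarrow> state \<Rightarrow> bool" where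
  "background_states G Um Up \<longleftrightarrow>
     pressure Um > 0 \<and> angle Um = 0 \<and> mach G Um > 1 \<and> temperature G Um > gas_T0 G \<and>
     0 < reactant Um \<and> reactant Um \<le> 1 \<and>
     pressure Up > 0 \<and> angle Up = 0 \<and> mach G Up < 1 \<and> reactant Up = reactant Um \<and>
     rankine_hugoniot G Um Up \<and>
     density G Um * speed Um = 1 \<and> density G Up * speed Up = 1"

text \<open>Derivative relative to a set, hence one-sided at the endpoints of an interval.\<close>

definition deriv_on :: "real set \<Rightarrow> (real \<Rightarrow> real) \<Rightarrow> real \<Rightarrow> real" where
  "deriv_on I f x = vector_derivative f (at x within I)"

text \<open>\<open>C\<^sup>2\<^sup>,\<^sup>\<alpha>(I)\<close> as the space of functions with finite Hoelder norm, also when \<open>I\<close> is unbounded.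
  Continuity of the second derivative follows from its Hoelder bound.\<close>

definition C2_holder :: "real \<Rightarrow> real set \<Rightarrow> (real \<Rightarrow> real) \<Rightarrow> bool" where
  "C2_holder \<alpha> I f \<longleftrightarrow>
     f differentiable_on I \<and> deriv_on I f differentiable_on I \<and>
     bounded (f ` I) \<and> bounded (deriv_on I f ` I) \<and> bounded (deriv_on I (deriv_on I f) ` I) \<and>
     (\<exists>C. \<forall>x\<in>I. \<forall>y\<in>I.
        \<bar>deriv_on I (deriv_on I f) x - deriv_on I (deriv_on I f) y\<bar> \<le> C * \<bar>x - y\<bar> powr \<alpha>)"

definition f1_plus :: "gas \<Rightarrow> state \<Rightarrow> real" where
  "f1_plus G Up =
     1 / (gas_gamma G * gas_cv G) * (1 / (density G Up * (speed Up)\<^sup>2)) *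
     (ignition G (temperature G Up) / temperature G Up) * gas_qe G * reactant Up"

definition K1 :: "gas \<Rightarrow> state \<Rightarrow> state \<Rightarrow> real" where
  "K1 G Um Up =
     (pressure Up - pressure Um) *
     ((gas_gamma G - 1) / (gas_gamma G * pressure Up) + 1 / (density G Up * (speed Up)\<^sup>2))"

definition K2 :: "gas \<Rightarrow> state \<Rightarrow> state \<Rightarrow> real" where
  "K2 G Um Up =
     1 / (gas_gamma G * gas_cv G) * (1 / temperature G Up) * gas_qe G * reactant Up *
     (ignition G (temperature G Up) / (density G Up * (speed Up)\<^sup>2)
      - ignition G (temperature G Um) / (density G Um * (speed Um)\<^sup>2))"

definition R_sigma :: "gas \<Rightarrow> state \<Rightarrow> state \<Rightarrow> real \<Rightarrow> (real \<Rightarrow> real) \<Rightarrow> real \<Rightarrow> real" where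
  "R_sigma G Um Up L \<Theta> \<xi> = integral {0..L} \<Theta> - K1 G Um Up * integral {0..\<xi>} \<Theta>"

definition R_kappa :: "gas \<Rightarrow> state \<Rightarrow> state \<Rightarrow> real \<Rightarrow> real \<Rightarrow> real" where
  "R_kappa G Um Up L \<xi> = - f1_plus G Up * L + K2 G Um Up * \<xi>"

definition R_total ::
  "gas \<Rightarrow> state \<Rightarrow> state \<Rightarrow> real \<Rightarrow> (real \<Rightarrow> real) \<Rightarrow> real \<Rightarrow> real \<Rightarrow> real \<Rightarrow> real" where
  "R_total G Um Up L \<Theta> \<xi> \<sigma> \<kappa> = \<sigma> * R_sigma G Um Up L \<Theta> \<xi> + \<kappa> * R_kappa G Um Up L \<xi>"

definition P_e :: "(real \<Rightarrow> real) \<Rightarrow> (real \<Rightarrow> real) \<Rightarrow> real \<Rightarrow> real \<Rightarrow> real \<Rightarrow> real" where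
  "P_e P\<sigma> P\<kappa> \<sigma> \<kappa> y = \<sigma> * P\<sigma> y + \<kappa> * P\<kappa> y"

definition P_star :: "gas \<Rightarrow> state \<Rightarrow> (real \<Rightarrow> real) \<Rightarrow> real" where
  "P_star G Up P =
     1 / (density G Up * speed Up) * ((1 - (mach G Up)\<^sup>2) / (density G Up * (speed Up)\<^sup>2)) *
     integral {0..1} P"

definition shock_eq ::
  "gas \<Rightarrow> state \<Rightarrow> state \<Rightarrow> real \<Rightarrow> (real \<Rightarrow> real) \<Rightarrow> (real \<Rightarrow> real) \<Rightarrow> (real \<Rightarrow> real) \<Rightarrow>
   real \<Rightarrow> real \<Rightarrow> real \<Rightarrow> bool" where
  "shock_eq G Um Up L \<Theta> P\<sigma> P\<kappa> \<sigma> \<kappa> \<xi> \<longleftrightarrow>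
     R_total G Um Up L \<Theta> \<xi> \<sigma> \<kappa> = P_star G Up (P_e P\<sigma> P\<kappa> \<sigma> \<kappa>)"

end

theory Submission
  imports Defs
begin

text \<open>
  The pressure functional is linear in the exit pressure, so for parameters related by a power law
  with exponent \<open>s\<close> the shock equation, divided by the leading parameter, reads
  \<open>f \<xi> + \<epsilon> * (g \<xi> - b) = a\<close>: here \<open>f\<close> and \<open>g\<close> are \<open>R_sigma\<close> and \<open>R_kappa\<close> in one order or the
  other, \<open>a\<close> and \<open>b\<close> are the corresponding averaged pressures, and \<open>\<epsilon>\<close> is a constant multiple of
  the leading parameter to the power \<open>s - 1\<close>.

  In the first two parts \<open>\<epsilon>\<close> is small and the unperturbed equation \<open>f \<xi> = a\<close> has a root at which
  \<open>f\<close> has nonzero derivative. Then \<open>f - a\<close> changes sign there at least linearly, so a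
  perturbation of size \<open>O(\<epsilon>)\<close> cannot undo the change of sign between two points at distance
  \<open>O(\<epsilon>)\<close> on either side, and the intermediate value theorem gives a root in between
  (\<open>perturbed_root\<close>, \<open>perturbed_root_power_scaling\<close>). The derivative of \<open>R_sigma\<close> is \<open>- K1\<close> times
  \<open>\<Theta>\<close> and that of \<open>R_kappa\<close> is \<open>K2\<close>. The constants \<open>K1\<close> and \<open>K2\<close> are nonzero because
  otherwise \<open>R_sigma\<close> or \<open>R_kappa\<close> would be constant, and no pressure would lie strictly between
  its infimum and its supremum.

  In the third part the parameter \<open>\<kappa>\<close> divides out altogether, so that a single application of
  the intermediate value theorem serves all \<open>\<kappa>\<close>. In the last part both components of the
  equation hold separately at the same point.
\<close>

section \<open>Roots of perturbed equations\<close>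

text \<open>A number above the infimum exceeds some value of \<open>f\<close>, and one below the supremum is exceeded
  by some value; the intermediate value theorem applies between these two points. The first two
  facts hold even for unbounded \<open>f\<close>, whose infimum or supremum in the reals is an unspecified
  default.\<close>

lemma value_between_INF_SUP_attained:
  fixes f :: "real \<Rightarrow> real"
  assumes cont: "continuous_on {l<..<u} f" and "l < u"
    and p: "p \<in> {(INF x\<in>{l<..<u}. f x)<..<(SUP x\<in>{l<..<u}. f x)}"
  shows "\<exists>x\<in>{l<..<u}. f x = p"
proof -
  have ne: "f ` {l<..<u} \<noteq> {}" using \<open>l < u\<close> by simp
  obtain x where x: "x \<in> {l<..<u}" "f x < p"
    using cInf_lessD[OF ne, of p] p by auto
  obtain y where y: "y \<in> {l<..<u}" "p < f y"
    using less_cSupD[OF ne, of p] p by auto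
  have "connected (f ` {l<..<u})"
    by (intro connected_continuous_image cont) simp
  then have "p \<in> f ` {l<..<u}"
    using x y by (meson connectedD_interval imageI less_imp_le)
  then show ?thesis by auto
qed

lemma not_between_INF_SUP_if_constant:
  fixes f :: "real \<Rightarrow> real"
  assumes "\<And>x. f x = c" and "l < u"
  shows "p \<notin> {(INF x\<in>{l<..<u}. f x)<..<(SUP x\<in>{l<..<u}. f x)}"
  using assms by simp

lemma perturbed_root_increasing:
  fixes f g :: "real \<Rightarrow> real"
  assumes cf: "continuous_on {l<..<u} f" and cg: "continuous_on {l<..<u} g"
    and x0: "x0 \<in> {l<..<u}" and der: "(f has_real_derivative d) (at x0)" and d: "d > 0"
  shows "\<exists>\<epsilon>0>0. \<exists>C. \<forall>\<epsilon>\<in>{0<..<\<epsilon>0}. \<exists>x\<in>{l<..<u}. f x + \<epsilon> * g x = f x0 \<and> \<bar>x - x0\<bar> \<le> C * \<epsilon>"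
proof -
  have "((\<lambda>x. (f x - f x0) / (x - x0)) \<longlongrightarrow> d) (at x0)"
    using der by (simp add: has_field_derivative_iff)
  then have "\<forall>\<^sub>F x in at x0. (f x - f x0) / (x - x0) > d / 2"
    by (rule order_tendstoD) (use d in simp)
  then obtain \<delta>1 where \<delta>1: "\<delta>1 > 0"
    "\<And>x. x \<noteq> x0 \<Longrightarrow> dist x x0 < \<delta>1 \<Longrightarrow> (f x - f x0) / (x - x0) > d / 2"
    by (auto simp: eventually_at)
  define \<delta> where "\<delta> = Min {\<delta>1, x0 - l, u - x0} / 2"
  have \<delta>: "\<delta> > 0" "\<delta> < \<delta>1" "\<delta> < x0 - l" "\<delta> < u - x0"
    using \<delta>1(1) x0 by (auto simp: \<delta>_def min_def)
  have sub: "{x0 - \<delta>..x0 + \<delta>} \<subseteq> {l<..<u}" using \<delta> by auto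
  have "bounded (g ` {x0 - \<delta>..x0 + \<delta>})"
    by (intro compact_imp_bounded compact_continuous_image continuous_on_subset[OF cg sub]) simp
  then obtain B where B: "B > 0" "\<And>x. x \<in> {x0 - \<delta>..x0 + \<delta>} \<Longrightarrow> \<bar>g x\<bar> \<le> B"
    by (auto simp: bounded_pos)
  \<comment> \<open>At distance \<open>C * \<epsilon>\<close> from \<open>x0\<close>, half the linear growth of \<open>f\<close> equals the bound \<open>\<epsilon> * B\<close> on the
      perturbation.\<close>
  define C where "C = 2 * B / d"
  have C: "C > 0" using B d by (simp add: C_def)
  have "\<exists>x\<in>{l<..<u}. f x + \<epsilon> * g x = f x0 \<and> \<bar>x - x0\<bar> \<le> C * \<epsilon>"
    if \<epsilon>: "\<epsilon> \<in> {0<..<\<delta> / C}" for \<epsilon>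
  proof -
    define r where "r = C * \<epsilon>"
    have r: "r > 0" "r < \<delta>" using \<epsilon> C by (auto simp: r_def field_simps)
    have dr: "d / 2 * r = \<epsilon> * B" using d by (simp add: r_def C_def)
    have bound: "\<bar>\<epsilon> * g x\<bar> \<le> \<epsilon> * B" if "x \<in> {x0 - \<delta>..x0 + \<delta>}" for x
      using B(2)[OF that] \<epsilon> by (simp add: abs_mult)
    have "f (x0 + r) - f x0 > d / 2 * r"
      using \<delta>1(2)[of "x0 + r"] r \<delta> by (simp add: dist_real_def field_simps)
    moreover have "\<bar>\<epsilon> * g (x0 + r)\<bar> \<le> \<epsilon> * B" using r by (intro bound) auto
    ultimately have hi: "f x0 \<le> f (x0 + r) + \<epsilon> * g (x0 + r)" using dr by linarith
    have "f (x0 - r) - f x0 < - (d / 2 * r)"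
      using \<delta>1(2)[of "x0 - r"] r \<delta> by (simp add: dist_real_def field_simps)
    moreover have "\<bar>\<epsilon> * g (x0 - r)\<bar> \<le> \<epsilon> * B" using r by (intro bound) auto
    ultimately have lo: "f (x0 - r) + \<epsilon> * g (x0 - r) \<le> f x0" using dr by linarith
    have sub_r: "{x0 - r..x0 + r} \<subseteq> {l<..<u}" using r \<delta> by auto
    have "continuous_on {x0 - r..x0 + r} (\<lambda>x. f x + \<epsilon> * g x)"
      by (intro continuous_intros continuous_on_subset[OF cf sub_r] continuous_on_subset[OF cg sub_r])
    then obtain x where "x0 - r \<le> x" "x \<le> x0 + r" "f x + \<epsilon> * g x = f x0"
      using IVT'[of "\<lambda>x. f x + \<epsilon> * g x", OF lo hi] r by auto
    then show ?thesis using sub_r by (intro bexI[of _ x]) (auto simp: r_def abs_le_iff)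
  qed
  then show ?thesis using \<delta>(1) C by (intro exI[of _ "\<delta> / C"] conjI exI[of _ C] ballI) simp_all
qed

lemma perturbed_root:
  fixes f g :: "real \<Rightarrow> real"
  assumes cf: "continuous_on {l<..<u} f" and cg: "continuous_on {l<..<u} g"
    and x0: "x0 \<in> {l<..<u}" and der: "(f has_real_derivative d) (at x0)" and "d \<noteq> 0"
  shows "\<exists>\<epsilon>0>0. \<exists>C. \<forall>\<epsilon>\<in>{0<..<\<epsilon>0}. \<exists>x\<in>{l<..<u}. f x + \<epsilon> * g x = f x0 \<and> \<bar>x - x0\<bar> \<le> C * \<epsilon>"
proof (cases "d > 0")
  case True
  show ?thesis by (rule perturbed_root_increasing[OF cf cg x0 der True])
next
  case False
  have neg: "- f x + \<epsilon> * (- g x) = - f x0 \<longleftrightarrow> f x + \<epsilon> * g x = f x0" for x \<epsilon>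
    by (simp only: mult_minus_right) linarith
  have "((\<lambda>x. - f x) has_real_derivative - d) (at x0)"
    using der by (rule DERIV_minus)
  then show ?thesis
    using perturbed_root_increasing[of l u "\<lambda>x. - f x" "\<lambda>x. - g x" x0 "- d", unfolded neg]
      cf cg x0 False \<open>d \<noteq> 0\<close> by (auto intro: continuous_on_minus)
qed

text \<open>Dividing by the leading parameter \<open>t\<close> leaves the perturbation parameter
  \<open>B * t powr (s - 1)\<close>, which falls below any positive bound for small \<open>t\<close> because \<open>s > 1\<close>.\<close>

lemma perturbed_root_power_scaling:
  fixes f g :: "real \<Rightarrow> real"
  assumes cf: "continuous_on {l<..<u} f" and cg: "continuous_on {l<..<u} g"
    and x0: "x0 \<in> {l<..<u}" and der: "(f has_real_derivative d) (at x0)" and "d \<noteq> 0"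
    and "s > 1" and "B > 0"
  shows "\<exists>t0>0. \<exists>C. \<forall>t\<in>{0<..<t0}. \<exists>x\<in>{l<..<u}.
    t * f x + B * t powr s * g x = t * f x0 + B * t powr s * b \<and> \<bar>x - x0\<bar> \<le> C * t powr (s - 1)"
proof -
  have cg': "continuous_on {l<..<u} (\<lambda>x. g x - b)" by (intro continuous_intros cg)
  obtain \<epsilon>0 C where \<epsilon>0: "\<epsilon>0 > 0" and root: "\<And>\<epsilon>. \<epsilon> \<in> {0<..<\<epsilon>0} \<Longrightarrow>
      \<exists>x\<in>{l<..<u}. f x + \<epsilon> * (g x - b) = f x0 \<and> \<bar>x - x0\<bar> \<le> C * \<epsilon>"
    using perturbed_root[OF cf cg' x0 der \<open>d \<noteq> 0\<close>] by blast
  \<comment> \<open>The value of \<open>t\<close> at which \<open>B * t powr (s - 1)\<close> reaches \<open>\<epsilon>0\<close>.\<close>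
  define t0 where "t0 = (\<epsilon>0 / B) powr (1 / (s - 1))"
  have t0: "t0 > 0" "t0 powr (s - 1) = \<epsilon>0 / B"
    using \<epsilon>0 \<open>B > 0\<close> \<open>s > 1\<close> by (auto simp: t0_def powr_powr)
  have "\<exists>x\<in>{l<..<u}. t * f x + B * t powr s * g x = t * f x0 + B * t powr s * b \<and>
      \<bar>x - x0\<bar> \<le> (C * B) * t powr (s - 1)" if t: "t \<in> {0<..<t0}" for t
  proof -
    define \<epsilon> where "\<epsilon> = B * t powr (s - 1)"
    have "t powr (s - 1) < \<epsilon>0 / B"
      using t \<open>s > 1\<close> powr_less_mono2[of "s - 1" t t0] t0 by auto
    then have "\<epsilon> \<in> {0<..<\<epsilon>0}" using t \<open>B > 0\<close> by (auto simp: \<epsilon>_def field_simps)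
    then obtain x where x: "x \<in> {l<..<u}" "f x + \<epsilon> * (g x - b) = f x0" "\<bar>x - x0\<bar> \<le> C * \<epsilon>"
      using root by blast
    have ts: "B * t powr s = t * \<epsilon>" using t by (simp add: \<epsilon>_def powr_diff)
    have "t * f x + t * \<epsilon> * g x = t * f x0 + t * \<epsilon> * b"
      by (subst x(2)[symmetric]) (simp add: algebra_simps)
    then show ?thesis using x ts by (intro bexI[of _ x]) (auto simp: \<epsilon>_def ac_simps)
  qed
  then show ?thesis using t0(1) by blast
qed

section \<open>The terms of the shock equation\<close>

lemma C2_holder_imp_continuous_on: "C2_holder \<alpha> I f \<Longrightarrow> continuous_on I f"
  by (auto simp: C2_holder_def intro: differentiable_imp_continuous_on)

lemma P_star_linear:
  assumes "continuous_on {0..1} P" and "continuous_on {0..1} Q"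
  shows "P_star G Up (\<lambda>y. a * P y + b * Q y) = a * P_star G Up P + b * P_star G Up Q"
proof -
  have "integral {0..1} (\<lambda>y. a * P y + b * Q y) = a * integral {0..1} P + b * integral {0..1} Q"
    using assms by (subst integral_add)
      (auto intro!: integrable_continuous_interval continuous_intros)
  then show ?thesis by (simp only: P_star_def distrib_left mult.left_commute)
qed

lemma shock_eq_linear:
  assumes "continuous_on {0..1} P\<sigma>" and "continuous_on {0..1} P\<kappa>"
  shows "shock_eq G Um Up L \<Theta> P\<sigma> P\<kappa> \<sigma> \<kappa> \<xi> \<longleftrightarrow>
    \<sigma> * R_sigma G Um Up L \<Theta> \<xi> + \<kappa> * R_kappa G Um Up L \<xi> =
    \<sigma> * P_star G Up P\<sigma> + \<kappa> * P_star G Up P\<kappa>"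
proof -
  have "P_star G Up (P_e P\<sigma> P\<kappa> \<sigma> \<kappa>) = \<sigma> * P_star G Up P\<sigma> + \<kappa> * P_star G Up P\<kappa>"
    unfolding P_e_def[abs_def] by (rule P_star_linear[OF assms])
  then show ?thesis by (simp add: shock_eq_def R_total_def)
qed

lemma R_sigma_has_real_derivative:
  assumes "continuous_on {0..L} \<Theta>" and "x \<in> {0<..<L}"
  shows "(R_sigma G Um Up L \<Theta> has_real_derivative - (K1 G Um Up * \<Theta> x)) (at x)"
proof -
  have "((\<lambda>\<xi>. integral {0..\<xi>} \<Theta>) has_real_derivative \<Theta> x) (at x within {0..L})"
    using assms by (intro integral_has_real_derivative) auto
  then have "((\<lambda>\<xi>. integral {0..\<xi>} \<Theta>) has_real_derivative \<Theta> x) (at x)"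
    using assms(2) by (simp add: at_within_Icc_at)
  then show ?thesis
    unfolding R_sigma_def[abs_def] by (auto intro!: derivative_eq_intros)
qed

lemma R_kappa_has_real_derivative:
  "(R_kappa G Um Up L has_real_derivative K2 G Um Up) (at x)"
  unfolding R_kappa_def[abs_def] by (auto intro!: derivative_eq_intros)

section \<open>Approximate shock positions\<close>

theorem theorem2p2:
  fixes G :: gas and Um Up :: state and L \<alpha> A A1 A2 :: real
    and \<Theta> P\<sigma> P\<kappa> :: "real \<Rightarrow> real"
  assumes "gas_constants G" and "L > 0" and "0 < \<alpha>" and "\<alpha> < 1"
    and "background_states G Um Up"
    and "C2_holder \<alpha> {0..L} \<Theta>"
    and "\<Theta> 0 = 0" and "deriv_on {0..L} \<Theta> 0 = 0"
    and "deriv_on {0..L} (deriv_on {0..L} \<Theta>) 0 = 0"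
    and "C2_holder \<alpha> {0..} P\<sigma>" and "C2_holder \<alpha> {0..} P\<kappa>"
    and "A > 0" and "A1 > 0" and "A2 > 0"
  shows
    "(\<forall>s>1. \<forall>\<xi>s\<in>{0<..<L}.
        P_star G Up P\<sigma> \<in> {(INF \<xi>\<in>{0<..<L}. R_sigma G Um Up L \<Theta> \<xi>)<..<
                          (SUP \<xi>\<in>{0<..<L}. R_sigma G Um Up L \<Theta> \<xi>)} \<longrightarrow>
        R_sigma G Um Up L \<Theta> \<xi>s = P_star G Up P\<sigma> \<longrightarrow> \<Theta> \<xi>s \<noteq> 0 \<longrightarrow>
        (\<exists>\<sigma>1>0. \<exists>C2. \<forall>\<sigma>\<in>{0<..<\<sigma>1}. \<exists>\<xi>\<in>{0<..<L}.
           shock_eq G Um Up L \<Theta> P\<sigma> P\<kappa> \<sigma> (A1 * \<sigma> powr s) \<xi> \<and>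
           \<bar>\<xi> - \<xi>s\<bar> \<le> C2 * \<sigma> powr (s - 1))) \<and>
     (\<forall>s>1. \<forall>\<xi>s\<in>{0<..<L}.
        P_star G Up P\<kappa> \<in> {(INF \<xi>\<in>{0<..<L}. R_kappa G Um Up L \<xi>)<..<
                          (SUP \<xi>\<in>{0<..<L}. R_kappa G Um Up L \<xi>)} \<longrightarrow>
        R_kappa G Um Up L \<xi>s = P_star G Up P\<kappa> \<longrightarrow>
        (\<exists>\<kappa>1>0. \<exists>C1. \<forall>\<kappa>\<in>{0<..<\<kappa>1}. \<exists>\<xi>\<in>{0<..<L}.
           shock_eq G Um Up L \<Theta> P\<sigma> P\<kappa> (A2 * \<kappa> powr s) \<kappa> \<xi> \<and>
           \<bar>\<xi> - \<xi>s\<bar> \<le> C1 * \<kappa> powr (s - 1))) \<and>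
     (P_star G Up (\<lambda>y. A * P\<sigma> y + P\<kappa> y) \<in>
          {(INF \<xi>\<in>{0<..<L}. A * R_sigma G Um Up L \<Theta> \<xi> + R_kappa G Um Up L \<xi>)<..<
           (SUP \<xi>\<in>{0<..<L}. A * R_sigma G Um Up L \<Theta> \<xi> + R_kappa G Um Up L \<xi>)} \<longrightarrow>
        (\<exists>\<xi>s\<in>{0<..<L}. \<forall>\<kappa>>0. shock_eq G Um Up L \<Theta> P\<sigma> P\<kappa> (A * \<kappa>) \<kappa> \<xi>s)) \<and>
     ((P_star G Up P\<sigma>, P_star G Up P\<kappa>) \<in>
          {(R_sigma G Um Up L \<Theta> \<xi>, R_kappa G Um Up L \<xi>) | \<xi>. \<xi> \<in> {0<..<L}} \<longrightarrow>
        (\<exists>\<xi>s\<in>{0<..<L}. \<forall>\<sigma>>0. \<forall>\<kappa>>0. shock_eq G Um Up L \<Theta> P\<sigma> P\<kappa> \<sigma> \<kappa> \<xi>s))"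
proof -
  let ?Rs = "R_sigma G Um Up L \<Theta>" and ?Rk = "R_kappa G Um Up L"
  let ?ps = "P_star G Up P\<sigma>" and ?pk = "P_star G Up P\<kappa>"
  have c\<Theta>: "continuous_on {0..L} \<Theta>"
    using \<open>C2_holder \<alpha> {0..L} \<Theta>\<close> by (rule C2_holder_imp_continuous_on)
  have cP: "continuous_on {0..1} P\<sigma>" "continuous_on {0..1} P\<kappa>"
    using C2_holder_imp_continuous_on[OF \<open>C2_holder \<alpha> {0..} P\<sigma>\<close>]
      C2_holder_imp_continuous_on[OF \<open>C2_holder \<alpha> {0..} P\<kappa>\<close>]
    by (auto elim!: continuous_on_subset)
  note eq = shock_eq_linear[OF cP]
  note ds = R_sigma_has_real_derivative[OF c\<Theta>]
  note dk = R_kappa_has_real_derivative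
  have cs: "continuous_on {0<..<L} ?Rs"
    by (intro continuous_at_imp_continuous_on ballI DERIV_isCont[OF ds])
  have ck: "continuous_on {0<..<L} ?Rk"
    by (intro continuous_at_imp_continuous_on ballI DERIV_isCont[OF dk])
  show ?thesis
  proof (intro conjI allI ballI impI, goal_cases)
    case (1 s \<xi>s)
    have "K1 G Um Up \<noteq> 0"
    proof
      assume "K1 G Um Up = 0"
      then have "?Rs x = integral {0..L} \<Theta>" for x by (simp add: R_sigma_def)
      from not_between_INF_SUP_if_constant[of ?Rs, OF this \<open>L > 0\<close>] 1(3) show False by blast
    qed
    then have "- (K1 G Um Up * \<Theta> \<xi>s) \<noteq> 0" using 1 by simp
    from perturbed_root_power_scaling
      [OF cs ck 1(2) ds[OF 1(2)] this \<open>s > 1\<close> \<open>A1 > 0\<close>, of ?pk]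
    show ?case unfolding eq 1(4) .
  next
    case (2 s \<xi>s)
    have "K2 G Um Up \<noteq> 0"
    proof
      assume "K2 G Um Up = 0"
      then have "?Rk x = - f1_plus G Up * L" for x by (simp add: R_kappa_def)
      from not_between_INF_SUP_if_constant[of ?Rk, OF this \<open>L > 0\<close>] 2(3) show False by blast
    qed
    from perturbed_root_power_scaling[OF ck cs 2(2) dk this \<open>s > 1\<close> \<open>A2 > 0\<close>, of ?ps]
    show ?case unfolding eq 2(4) by (simp only: add.commute)
  next
    case 3
    have "continuous_on {0<..<L} (\<lambda>\<xi>. A * ?Rs \<xi> + ?Rk \<xi>)"
      by (intro continuous_intros cs ck)
    from value_between_INF_SUP_attained[OF this \<open>L > 0\<close> 3]
    obtain \<xi> where \<xi>: "\<xi> \<in> {0<..<L}" "A * ?Rs \<xi> + ?Rk \<xi> = A * ?ps + ?pk"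
      using P_star_linear[OF cP, of G Up A 1] by auto
    have "(A * \<kappa>) * ?Rs \<xi> + \<kappa> * ?Rk \<xi> = (A * \<kappa>) * ?ps + \<kappa> * ?pk" for \<kappa>
      using arg_cong[OF \<xi>(2), of "\<lambda>x. \<kappa> * x"] by (simp add: algebra_simps)
    then show ?case using \<xi>(1) unfolding eq by blast
  next
    case 4
    then show ?case unfolding eq by auto
  qed
qed

end
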